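(* Let $s\ge1$ and let $a_{ij},b_i$ ($i,j=1,\dots,s$) be real numbers satisfying $$b_ia_{ij}+b_ja_{ji}=b_ib_j,\qquad\forall\, i,j=1,\dots,s.$$ Let $(\boldsymbol{B}^n,\boldsymbol{\rho}^n,\boldsymbol{u}^n,\boldsymbol{\phi}^n)_{n\ge0}$ in $\mathbb{V}_h$ be generated by the fully discrete Runge–Kutta scheme with these coefficients (the scheme described in the context), with $\boldsymbol{\phi}^0=|\boldsymbol{B}^0|^2$. Then the discrete Hamiltonian energy is conserved: $$\mathcal{H}_h^{n+1}=\mathcal{H}_h^n,\qquad n=0,1,2,\dots,$$ where $$\mathcal{H}_h^n=\omega\langle\mathcal{D}_2\boldsymbol{B}^n,\boldsymbol{B}^n\rangle_h-\kappa\langle\boldsymbol{u}^n-\tfrac\nu2\boldsymbol{\rho}^n+\tfrac q2|\boldsymbol{B}^n|^2,|\boldsymbol{B}^n|^2\rangle_h-\tfrac\beta2\langle\boldsymbol{\rho}^n,\boldsymbol{\rho}^n\rangle_h-\tfrac12\langle\boldsymbol{u}^n,\boldsymbol{u}^n\rangle_h+\nu\langle\boldsymbol{u}^n,\boldsymbol{\rho}^n\rangle_h.$$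
   Context: $\omega,\kappa,\nu,\beta,q$ are given real constants with $q=\kappa+\frac{\nu(\kappa\nu-1)}{4(\beta-\nu^2)}$ (so $\beta\ne\nu^2$). $\Omega=[a,b]$, $N$ is a positive even integer, $h=(b-a)/N$, $x_j=a+jh$, $\mu=\frac{2\pi}{b-a}$, and $\tau>0$ is the time step. $\mathbb{V}_h$ is the space of periodic mesh functions, written as vectors $\boldsymbol{U}=(U_0,\dots,U_{N-1})^T$; the $\boldsymbol{B}$-variables have complex entries, while the $\boldsymbol{\rho},\boldsymbol{u},\boldsymbol{\phi}$-variables (including internal stages) have real entries. $\langle\boldsymbol{U},\boldsymbol{V}\rangle_h=h\sum_{j=0}^{N-1}U_j\bar V_j$; $\boldsymbol{U}\cdot\boldsymbol{V}$ is the componentwise product; $|\boldsymbol{U}|^2=\boldsymbol{U}\cdot\bar{\boldsymbol{U}}$ (componentwise); $\mathrm{Re}$ is taken componentwise. Fourier pseudo-spectral differentiation matrices: $(\mathcal{D}_m)_{j,k}=\frac{d^m g_k}{dx^m}(x_j)$, $j,k=0,\dots,N-1$, where $g_j(x)=\frac1N\sum_{l=-N/2}^{N/2}\frac1{c_l}e^{\mathrm{i}l\mu(x-x_j)}$ with $c_l=1$ for $|l|<N/2$ and $c_l=2$ for $|l|=N/2$. Equivalently, $\mathcal{D}_1=\mathcal{F}_N^H\Lambda^1\mathcal{F}_N$ and $\mathcal{D}_2=\mathcal{F}_N^H\Lambda^2\mathcal{F}_N$, with $(\mathcal{F}_N)_{j,k}=\frac1{\sqrt N}e^{-\mathrm{i}jk\frac{2\pi}{N}}$,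 $\mathcal{F}_N^H$ its conjugate transpose, $\Lambda^1=\mathrm{i}\mu\,\mathrm{diag}(0,1,\dots,\frac N2-1,0,-\frac N2+1,\dots,-1)$ and $\Lambda^2=[\mathrm{i}\mu\,\mathrm{diag}(0,1,\dots,\frac N2-1,\frac N2,-\frac N2+1,\dots,-1)]^2$. Scheme ($s$-stage Runge–Kutta method with real coefficients $b_i,a_{ij}$, and $c_i=\sum_{j=1}^sa_{ij}$): given $\boldsymbol{B}^n,\boldsymbol{\rho}^n,\boldsymbol{u}^n,\boldsymbol{\phi}^n\in\mathbb{V}_h$, the stages satisfy, for $i=1,\dots,s$, $$\begin{aligned}&\boldsymbol{B}_{ni}=\boldsymbol{B}^n+\tau\sum_{j=1}^sa_{ij}k_j^1,& &k_i^1=\mathrm{i}\big(\omega\mathcal{D}_2\boldsymbol{B}_{ni}-\kappa(\boldsymbol{u}_{ni}-\tfrac12\nu\boldsymbol{\rho}_{ni}+q\boldsymbol{\phi}_{ni})\cdot\boldsymbol{B}_{ni}\big),\\&\boldsymbol{\rho}_{ni}=\boldsymbol{\rho}^n+\tau\sum_{j=1}^sa_{ij}k_j^2,& &k_i^2=\mathcal{D}_1\big(-\boldsymbol{u}_{ni}+\nu\boldsymbol{\rho}_{ni}-\kappa\boldsymbol{\phi}_{ni}\big),\\&\boldsymbol{u}_{ni}=\boldsymbol{u}^n+\tau\sum_{j=1}^sa_{ij}k_j^3,& &k_i^3=\mathcal{D}_1\big(-\beta\boldsymbol{\rho}_{ni}+\nu\boldsymbol{u}_{ni}+\tfrac12\kappa\nu\boldsymbol{\phi}_{ni}\big),\\&\boldsymbol{\phi}_{ni}=\boldsymbol{\phi}^n+\tau\sum_{j=1}^sa_{ij}k_j^4,&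 &k_i^4=2\,\mathrm{Re}(\bar{\boldsymbol{B}}_{ni}\cdot k_i^1),\end{aligned}$$ and the update is $\boldsymbol{B}^{n+1}=\boldsymbol{B}^n+\tau\sum_{i=1}^sb_ik_i^1$, $\boldsymbol{\rho}^{n+1}=\boldsymbol{\rho}^n+\tau\sum_{i=1}^sb_ik_i^2$, $\boldsymbol{u}^{n+1}=\boldsymbol{u}^n+\tau\sum_{i=1}^sb_ik_i^3$, $\boldsymbol{\phi}^{n+1}=\boldsymbol{\phi}^n+\tau\sum_{i=1}^sb_ik_i^4$. A sequence is "generated by the scheme" if at each step some stage values satisfying these (implicit) equations exist and give the update. *)

theory Defs
  imports "HOL-Analysis.Analysis"
begin

(* A periodic mesh function is represented by its values at the indices 0, ..., N - 1;
   values at indices \<ge> N are never read and never constrained. *)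

type_synonym cmesh = "nat \<Rightarrow> complex"
type_synonym rmesh = "nat \<Rightarrow> real"

definition cmesh_of :: "rmesh \<Rightarrow> cmesh" where
  "cmesh_of U = (\<lambda>j. complex_of_real (U j))"

definition mesh_size :: "real \<Rightarrow> real \<Rightarrow> nat \<Rightarrow> real" where
  "mesh_size xa xb N = (xb - xa) / real N"

definition mesh_point :: "real \<Rightarrow> real \<Rightarrow> nat \<Rightarrow> nat \<Rightarrow> real" where
  "mesh_point xa xb N j = xa + real j * mesh_size xa xb N"

definition inner_h :: "real \<Rightarrow> real \<Rightarrow> nat \<Rightarrow> cmesh \<Rightarrow> cmesh \<Rightarrow> complex" where
  "inner_h xa xb N U V = complex_of_real (mesh_size xa xb N) * (\<Sum>j<N. U j * cnj (V j))"

definition abs_sq :: "cmesh \<Rightarrow> cmesh" where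
  "abs_sq U = (\<lambda>j. U j * cnj (U j))"

definition trig_weight :: "nat \<Rightarrow> int \<Rightarrow> real" where
  "trig_weight N l = (if \<bar>l\<bar> = int (N div 2) then 2 else 1)"

definition trig_basis :: "real \<Rightarrow> real \<Rightarrow> nat \<Rightarrow> nat \<Rightarrow> real \<Rightarrow> complex" where
  "trig_basis xa xb N k x =
     1 / of_nat N * (\<Sum>l = - int (N div 2)..int (N div 2).
        1 / complex_of_real (trig_weight N l) *
        exp (\<i> * of_int l * complex_of_real (2 * pi / (xb - xa)) *
             complex_of_real (x - mesh_point xa xb N k)))"

(* Entry (j, k) is the m-th derivative, with respect to the real variable x, of the complex-valued
   function trig_basis xa xb N k at the mesh point x_j. *)
definition diff_matrix :: "real \<Rightarrow> real \<Rightarrow> nat \<Rightarrow> nat \<Rightarrow> nat \<Rightarrow> nat \<Rightarrow> complex" where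
  "diff_matrix xa xb N m j k =
     ((\<lambda>f x. vector_derivative f (at x)) ^^ m) (trig_basis xa xb N k) (mesh_point xa xb N j)"

definition mesh_diff :: "real \<Rightarrow> real \<Rightarrow> nat \<Rightarrow> nat \<Rightarrow> cmesh \<Rightarrow> cmesh" where
  "mesh_diff xa xb N m U = (\<lambda>j. \<Sum>k<N. diff_matrix xa xb N m j k * U k)"

(* Stage values (Bs, rs, us, ps) and slopes k1, ..., k4 carry the stage index in {1..s} first and
   the mesh index second. The slopes k2 and k3 are real; since the entries of diff_matrix have type
   complex, their defining equations are stated in the complex numbers. These entries are in fact
   real, so no extra condition is imposed. *)
definition rk_stages ::
  "real \<Rightarrow> real \<Rightarrow> real \<Rightarrow> real \<Rightarrow> real \<Rightarrow> real \<Rightarrow> real \<Rightarrow> nat \<Rightarrow> real \<Rightarrow>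
   nat \<Rightarrow> (nat \<Rightarrow> nat \<Rightarrow> real) \<Rightarrow>
   cmesh \<Rightarrow> rmesh \<Rightarrow> rmesh \<Rightarrow> rmesh \<Rightarrow>
   (nat \<Rightarrow> cmesh) \<Rightarrow> (nat \<Rightarrow> rmesh) \<Rightarrow> (nat \<Rightarrow> rmesh) \<Rightarrow> (nat \<Rightarrow> rmesh) \<Rightarrow>
   (nat \<Rightarrow> cmesh) \<Rightarrow> (nat \<Rightarrow> rmesh) \<Rightarrow> (nat \<Rightarrow> rmesh) \<Rightarrow> (nat \<Rightarrow> rmesh) \<Rightarrow> bool" where
  "rk_stages \<omega> \<kappa> \<nu> \<beta> q xa xb N \<tau> s A B \<rho> u \<phi> Bs rs us ps k1 k2 k3 k4 \<longleftrightarrow>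
    (\<forall>i\<in>{1..s}. \<forall>l<N.
       Bs i l = B l + complex_of_real \<tau> * (\<Sum>j=1..s. complex_of_real (A i j) * k1 j l) \<and>
       rs i l = \<rho> l + \<tau> * (\<Sum>j=1..s. A i j * k2 j l) \<and>
       us i l = u l + \<tau> * (\<Sum>j=1..s. A i j * k3 j l) \<and>
       ps i l = \<phi> l + \<tau> * (\<Sum>j=1..s. A i j * k4 j l) \<and>
       k1 i l = \<i> * (complex_of_real \<omega> * mesh_diff xa xb N 2 (Bs i) l
                  - complex_of_real (\<kappa> * (us i l - \<nu> / 2 * rs i l + q * ps i l)) * Bs i l) \<and>
       complex_of_real (k2 i l) =
         mesh_diff xa xb N 1 (cmesh_of (\<lambda>m. - us i m + \<nu> * rs i m - \<kappa> * ps i m)) l \<and>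
       complex_of_real (k3 i l) =
         mesh_diff xa xb N 1 (cmesh_of (\<lambda>m. - \<beta> * rs i m + \<nu> * us i m + \<kappa> * \<nu> / 2 * ps i m)) l \<and>
       k4 i l = 2 * Re (cnj (Bs i l) * k1 i l))"

definition rk_step ::
  "real \<Rightarrow> real \<Rightarrow> real \<Rightarrow> real \<Rightarrow> real \<Rightarrow> real \<Rightarrow> real \<Rightarrow> nat \<Rightarrow> real \<Rightarrow>
   nat \<Rightarrow> (nat \<Rightarrow> nat \<Rightarrow> real) \<Rightarrow> (nat \<Rightarrow> real) \<Rightarrow>
   cmesh \<Rightarrow> rmesh \<Rightarrow> rmesh \<Rightarrow> rmesh \<Rightarrow> cmesh \<Rightarrow> rmesh \<Rightarrow> rmesh \<Rightarrow> rmesh \<Rightarrow> bool" where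
  "rk_step \<omega> \<kappa> \<nu> \<beta> q xa xb N \<tau> s A w B \<rho> u \<phi> B' \<rho>' u' \<phi>' \<longleftrightarrow>
    (\<exists>Bs rs us ps k1 k2 k3 k4.
       rk_stages \<omega> \<kappa> \<nu> \<beta> q xa xb N \<tau> s A B \<rho> u \<phi> Bs rs us ps k1 k2 k3 k4 \<and>
       (\<forall>l<N.
          B' l = B l + complex_of_real \<tau> * (\<Sum>i=1..s. complex_of_real (w i) * k1 i l) \<and>
          \<rho>' l = \<rho> l + \<tau> * (\<Sum>i=1..s. w i * k2 i l) \<and>
          u' l = u l + \<tau> * (\<Sum>i=1..s. w i * k3 i l) \<and>
          \<phi>' l = \<phi> l + \<tau> * (\<Sum>i=1..s. w i * k4 i l)))"

definition energy_h ::
  "real \<Rightarrow> real \<Rightarrow> real \<Rightarrow> real \<Rightarrow> real \<Rightarrow> real \<Rightarrow> real \<Rightarrow> nat \<Rightarrow>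
   cmesh \<Rightarrow> rmesh \<Rightarrow> rmesh \<Rightarrow> complex" where
  "energy_h \<omega> \<kappa> \<nu> \<beta> q xa xb N B \<rho> u =
     complex_of_real \<omega> * inner_h xa xb N (mesh_diff xa xb N 2 B) B
     - complex_of_real \<kappa> *
         inner_h xa xb N
           (\<lambda>j. complex_of_real (u j) - complex_of_real (\<nu> / 2) * complex_of_real (\<rho> j)
                + complex_of_real (q / 2) * abs_sq B j)
           (abs_sq B)
     - complex_of_real (\<beta> / 2) * inner_h xa xb N (cmesh_of \<rho>) (cmesh_of \<rho>)
     - 1 / 2 * inner_h xa xb N (cmesh_of u) (cmesh_of u)
     + complex_of_real \<nu> * inner_h xa xb N (cmesh_of u) (cmesh_of \<rho>)"

end

theory Submission
  imports Defs
begin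

text \<open>
  Along a Runge--Kutta step with \<open>w\<^sub>i a\<^sub>i\<^sub>j + w\<^sub>j a\<^sub>j\<^sub>i = w\<^sub>i w\<^sub>j\<close>, products of two
  solution components obey an exact discrete Leibniz rule, in which the increment of \<open>x y\<close> is
  \<open>\<tau> \<Sum> w\<^sub>i (X\<^sub>i m\<^sub>i + k\<^sub>i Y\<^sub>i)\<close>, with stages \<open>X, Y\<close> and slopes \<open>k, m\<close>. Applied to \<open>B\<close> and its conjugate it
  shows that \<open>\<phi> = \<bar>B\<bar>\<^sup>2\<close> persists, so that the energy becomes quadratic in \<open>(B, \<rho>, u, \<phi>)\<close>. Its increment is then
  a sum of stage contributions, each of which vanishes because the second-order differentiation
  matrix is real symmetric and the first-order one real antisymmetric.
\<close>

section \<open>Symmetry and reality of the Fourier differentiation matrices\<close>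

lemma trig_basis_iterated_derivative:
  "((\<lambda>f x. vector_derivative f (at x)) ^^ m) (trig_basis xa xb N k) =
   (\<lambda>x. 1 / of_nat N * (\<Sum>l = - int (N div 2)..int (N div 2).
      1 / complex_of_real (trig_weight N l) *
      (\<i> * of_int l * complex_of_real (2 * pi / (xb - xa))) ^ m *
      exp (\<i> * of_int l * complex_of_real (2 * pi / (xb - xa)) *
           complex_of_real (x - mesh_point xa xb N k))))"
proof (induction m)
  case 0
  show ?case by (simp add: trig_basis_def fun_eq_iff)
next
  case (Suc m)
  define z where "z l = \<i> * of_int l * complex_of_real (2 * pi / (xb - xa))" for l :: int
  define d where "d l = 1 / complex_of_real (trig_weight N l)" for l
  define L where "L = {- int (N div 2)..int (N div 2)}"
  define y where "y = mesh_point xa xb N k"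
  have "vector_derivative
          (\<lambda>x. 1 / of_nat N * (\<Sum>l\<in>L. d l * z l ^ m * exp (z l * complex_of_real (x - y)))) (at x) =
        1 / of_nat N * (\<Sum>l\<in>L. d l * z l ^ Suc m * exp (z l * complex_of_real (x - y)))" for x
  proof -
    \<comment> \<open>The trigonometric sum is extended to a complex variable \<open>v\<close>; its
      complex derivative at a real point is the vector derivative along the real axis.\<close>
    have "((\<lambda>v. 1 / of_nat N * (\<Sum>l\<in>L. d l * z l ^ m * exp (z l * (v - of_real y))))
            has_field_derivative
          1 / of_nat N * (\<Sum>l\<in>L. d l * z l ^ Suc m * exp (z l * complex_of_real (x - y))))
          (at (of_real x))"
      by (rule derivative_eq_intros refl | simp add: algebra_simps)+
    from vector_derivative_at[OF has_vector_derivative_real_field[OF this]] show ?thesis by simp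
  qed
  then show ?case
    unfolding z_def d_def L_def y_def
    by (simp only: funpow.simps o_def Suc.IH)
qed

lemma diff_matrix_eq:
  "diff_matrix xa xb N m j k =
   1 / of_nat N * (\<Sum>l = - int (N div 2)..int (N div 2).
      1 / complex_of_real (trig_weight N l) *
      (\<i> * of_int l * complex_of_real (2 * pi / (xb - xa))) ^ m *
      exp (\<i> * of_int l * complex_of_real (2 * pi / (xb - xa)) *
           complex_of_real (mesh_point xa xb N j - mesh_point xa xb N k)))"
  by (simp add: diff_matrix_def trig_basis_iterated_derivative)

lemma sum_int_symmetric_reflect:
  "(\<Sum>l = - n..n. f l) = (\<Sum>l = - n..n. f (- l))" for n :: int and f :: "int \<Rightarrow> 'a::comm_monoid_add"
  by (rule sum.reindex_bij_witness[of _ uminus uminus]) auto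

text \<open>Exchanging the two mesh points negates every exponent. Reflecting the frequencies by
  \<open>l\<close> to \<open>- l\<close> undoes this, leaves the even weights alone, and costs one
  sign for each of the \<open>m\<close> factors linear in \<open>l\<close>.\<close>

lemma diff_matrix_swap:
  "diff_matrix xa xb N m k j = (- 1) ^ m * diff_matrix xa xb N m j k"
proof -
  define z where "z = \<i> * complex_of_real (2 * pi / (xb - xa))"
  define c where "c = complex_of_real (mesh_point xa xb N j - mesh_point xa xb N k)"
  have z: "\<i> * of_int l * complex_of_real (2 * pi / (xb - xa)) = of_int l * z" for l
    by (simp add: z_def)
  have c: "complex_of_real (mesh_point xa xb N k - mesh_point xa xb N j) = - c"
    by (simp add: c_def)
  show ?thesis
    unfolding diff_matrix_eq z c c_def[symmetric]
    by (subst sum_int_symmetric_reflect)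
      (simp add: trig_weight_def sum_distrib_left power_minus[of "z * of_int _"] mult_ac)
qed

text \<open>Conjugation acts on each Fourier mode exactly as the reflection of \<open>l\<close> to
  \<open>- l\<close>, and the frequency range and the weights are symmetric.\<close>

lemma cnj_diff_matrix [simp]: "cnj (diff_matrix xa xb N m j k) = diff_matrix xa xb N m j k"
  unfolding diff_matrix_eq
  by (subst (2) sum_int_symmetric_reflect) (simp add: trig_weight_def exp_cnj)

lemma cnj_mesh_diff: "cnj (mesh_diff xa xb N m U j) = mesh_diff xa xb N m (\<lambda>k. cnj (U k)) j"
  by (simp add: mesh_diff_def)

text \<open>Discrete integration by parts, for a pairing without conjugation. It is used with
  \<open>m = 2\<close> (symmetric) and \<open>m = 1\<close> (antisymmetric).\<close>

lemma sum_mesh_diff_swap: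
  "(\<Sum>j<N. mesh_diff xa xb N m U j * V j) = (- 1) ^ m * (\<Sum>j<N. U j * mesh_diff xa xb N m V j)"
proof -
  have "(\<Sum>j<N. mesh_diff xa xb N m U j * V j) =
        (\<Sum>j<N. \<Sum>k<N. diff_matrix xa xb N m j k * U k * V j)"
    by (simp add: mesh_diff_def sum_distrib_right)
  also have "\<dots> = (\<Sum>k<N. \<Sum>j<N. diff_matrix xa xb N m j k * U k * V j)"
    by (rule sum.swap)
  also have "\<dots> = (- 1) ^ m * (\<Sum>k<N. U k * mesh_diff xa xb N m V k)"
    unfolding mesh_diff_def sum_distrib_left
    by (subst diff_matrix_swap) (simp add: mult_ac)
  finally show ?thesis .
qed

section \<open>Discrete Leibniz rule for Runge-Kutta steps\<close>

text \<open>The slopes \<open>k\<close> are arbitrary numbers, not tied to any vector field. The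
  relation is therefore preserved by conjugation and by constant linear maps, and any two components
  with the same coefficients can be multiplied.\<close>

definition rk_component ::
  "real \<Rightarrow> nat \<Rightarrow> (nat \<Rightarrow> nat \<Rightarrow> real) \<Rightarrow> (nat \<Rightarrow> real) \<Rightarrow>
   complex \<Rightarrow> (nat \<Rightarrow> complex) \<Rightarrow> (nat \<Rightarrow> complex) \<Rightarrow> complex \<Rightarrow> bool" where
  "rk_component \<tau> s A w x X k x' \<longleftrightarrow>
     (\<forall>i\<in>{1..s}. X i = x + of_real \<tau> * (\<Sum>j=1..s. of_real (A i j) * k j)) \<and>
     x' = x + of_real \<tau> * (\<Sum>i=1..s. of_real (w i) * k i)"

text \<open>Embedding the real unknowns in the complex numbers lets one product rule serve all pairs
  of variables.\<close>

lemma rk_component_of_real: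
  assumes "\<forall>i\<in>{1..s}. X i = x + \<tau> * (\<Sum>j=1..s. A i j * k j)"
    and "x' = x + \<tau> * (\<Sum>i=1..s. w i * k i)"
  shows "rk_component \<tau> s A w (of_real x) (\<lambda>i. of_real (X i)) (\<lambda>i. of_real (k i)) (of_real x')"
  using assms by (simp add: rk_component_def)

lemma rk_component_cnj:
  assumes "rk_component \<tau> s A w x X k x'"
  shows "rk_component \<tau> s A w (cnj x) (\<lambda>i. cnj (X i)) (\<lambda>i. cnj (k i)) (cnj x')"
  using assms by (simp add: rk_component_def)

lemma mesh_diff_linear_combination:
  assumes "\<And>j. j < N \<Longrightarrow> U j = V j + t * (\<Sum>i\<in>I. a i * W i j)"
  shows "mesh_diff xa xb N m U j = mesh_diff xa xb N m V j + t * (\<Sum>i\<in>I. a i * mesh_diff xa xb N m (W i) j)"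
proof -
  have "mesh_diff xa xb N m U j =
      (\<Sum>k<N. diff_matrix xa xb N m j k * V k) +
      (\<Sum>k<N. \<Sum>i\<in>I. t * (a i * (diff_matrix xa xb N m j k * W i k)))"
    by (simp add: mesh_diff_def assms algebra_simps sum.distrib sum_distrib_left)
  also have "(\<Sum>k<N. \<Sum>i\<in>I. t * (a i * (diff_matrix xa xb N m j k * W i k))) =
      (\<Sum>i\<in>I. \<Sum>k<N. t * (a i * (diff_matrix xa xb N m j k * W i k)))"
    by (rule sum.swap)
  finally show ?thesis by (simp add: mesh_diff_def sum_distrib_left)
qed

text \<open>Differentiation in space is linear and does not change during the step. Only mesh values
  below \<open>N\<close> are read, so the conclusion needs no bound on its index
  \<open>l\<close>.\<close>

lemma rk_component_mesh_diff:
  assumes "\<And>l. l < N \<Longrightarrow> rk_component \<tau> s A w (x l) (\<lambda>i. X i l) (\<lambda>i. k i l) (x' l)"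
  shows "rk_component \<tau> s A w (mesh_diff xa xb N m x l) (\<lambda>i. mesh_diff xa xb N m (X i) l)
           (\<lambda>i. mesh_diff xa xb N m (k i) l) (mesh_diff xa xb N m x' l)"
  unfolding rk_component_def
  by (intro conjI ballI mesh_diff_linear_combination) (use assms in \<open>auto simp: rk_component_def\<close>)

text \<open>Expressing \<open>x\<close> and \<open>y\<close> through the stages in the first-order
  terms leaves a remainder quadratic in \<tau>. The coefficient of \<open>k i * m j\<close> there is
  \<open>w i * A i j + w j * A j i\<close>, which the hypothesis matches with
  \<open>w i * w j\<close> from the product of the two updates.\<close>

lemma rk_component_mult:
  assumes symp: "\<forall>i\<in>{1..s}. \<forall>j\<in>{1..s}. w i * A i j + w j * A j i = w i * w j"
    and x: "rk_component \<tau> s A w x X k x'" and y: "rk_component \<tau> s A w y Y m y'"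
  shows "x' * y' = x * y + of_real \<tau> * (\<Sum>i=1..s. of_real (w i) * (X i * m i + k i * Y i))"
proof -
  define t where "t = complex_of_real \<tau>"
  define a where "a i j = complex_of_real (A i j)" for i j
  define v where "v i = complex_of_real (w i)" for i
  define I where "I = {1..s}"
  have X: "X i = x + t * (\<Sum>j\<in>I. a i j * k j)" and Y: "Y i = y + t * (\<Sum>j\<in>I. a i j * m j)"
    if "i \<in> I" for i
    using x y that by (auto simp: rk_component_def t_def a_def I_def)
  have x': "x' = x + t * (\<Sum>i\<in>I. v i * k i)" and y': "y' = y + t * (\<Sum>i\<in>I. v i * m i)"
    using x y by (auto simp: rk_component_def t_def v_def I_def)
  have s: "v i * a i j + v j * a j i = v i * v j" if "i \<in> I" "j \<in> I" for i j
  proof -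
    have "w i * A i j + w j * A j i = w i * w j"
      using symp that unfolding I_def by blast
    then show ?thesis
      by (simp only: v_def a_def of_real_mult[symmetric] of_real_add[symmetric])
  qed
  have "(\<Sum>i\<in>I. v i * (X i * m i + k i * Y i)) =
        (\<Sum>i\<in>I. v i * (x * m i + k i * y)) +
        t * ((\<Sum>i\<in>I. \<Sum>j\<in>I. v i * a i j * k j * m i) + (\<Sum>i\<in>I. \<Sum>j\<in>I. v i * a i j * k i * m j))"
    by (simp add: X Y algebra_simps sum.distrib sum_distrib_left)
  \<comment> \<open>Renaming the indices gives both double sums the factor \<open>k i * m j\<close>,
    so that their coefficients add up to the left side of \<open>s\<close>.\<close>
  also have "(\<Sum>i\<in>I. \<Sum>j\<in>I. v i * a i j * k j * m i) = (\<Sum>i\<in>I. \<Sum>j\<in>I. v j * a j i * k i * m j)"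
    by (rule sum.swap)
  also have "\<dots> + (\<Sum>i\<in>I. \<Sum>j\<in>I. v i * a i j * k i * m j) =
      (\<Sum>i\<in>I. \<Sum>j\<in>I. (v i * a i j + v j * a j i) * k i * m j)"
    by (simp add: algebra_simps sum.distrib)
  also have "\<dots> = (\<Sum>i\<in>I. v i * k i) * (\<Sum>j\<in>I. v j * m j)"
    by (simp add: s sum_product mult_ac)
  finally have "(\<Sum>i\<in>I. v i * (X i * m i + k i * Y i)) =
      x * (\<Sum>i\<in>I. v i * m i) + (\<Sum>i\<in>I. v i * k i) * y
      + t * ((\<Sum>i\<in>I. v i * k i) * (\<Sum>j\<in>I. v j * m j))"
    by (simp add: algebra_simps sum.distrib sum_distrib_left)
  then show ?thesis
    unfolding x' y' t_def[symmetric] v_def[symmetric] I_def[symmetric]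
    by (simp add: algebra_simps)
qed

section \<open>Persistence of the constraint between \<phi> and \<open>B\<close>\<close>

lemma rk_stages_components:
  assumes st: "rk_stages \<omega> \<kappa> \<nu> \<beta> q xa xb N \<tau> s A B \<rho> u \<phi> Bs rs us ps k1 k2 k3 k4"
    and up: "\<forall>l<N. B' l = B l + complex_of_real \<tau> * (\<Sum>i=1..s. complex_of_real (w i) * k1 i l) \<and>
          \<rho>' l = \<rho> l + \<tau> * (\<Sum>i=1..s. w i * k2 i l) \<and>
          u' l = u l + \<tau> * (\<Sum>i=1..s. w i * k3 i l) \<and>
          \<phi>' l = \<phi> l + \<tau> * (\<Sum>i=1..s. w i * k4 i l)"
    and l: "l < N"
  shows "rk_component \<tau> s A w (B l) (\<lambda>i. Bs i l) (\<lambda>i. k1 i l) (B' l)"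
    and "rk_component \<tau> s A w (of_real (\<rho> l)) (\<lambda>i. of_real (rs i l)) (\<lambda>i. of_real (k2 i l)) (of_real (\<rho>' l))"
    and "rk_component \<tau> s A w (of_real (u l)) (\<lambda>i. of_real (us i l)) (\<lambda>i. of_real (k3 i l)) (of_real (u' l))"
    and "rk_component \<tau> s A w (of_real (\<phi> l)) (\<lambda>i. of_real (ps i l)) (\<lambda>i. of_real (k4 i l)) (of_real (\<phi>' l))"
proof -
  show "rk_component \<tau> s A w (B l) (\<lambda>i. Bs i l) (\<lambda>i. k1 i l) (B' l)"
    using st up l unfolding rk_stages_def rk_component_def by blast
  show "rk_component \<tau> s A w (of_real (\<rho> l)) (\<lambda>i. of_real (rs i l)) (\<lambda>i. of_real (k2 i l)) (of_real (\<rho>' l))"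
    by (rule rk_component_of_real) (use st up l in \<open>unfold rk_stages_def, blast+\<close>)
  show "rk_component \<tau> s A w (of_real (u l)) (\<lambda>i. of_real (us i l)) (\<lambda>i. of_real (k3 i l)) (of_real (u' l))"
    by (rule rk_component_of_real) (use st up l in \<open>unfold rk_stages_def, blast+\<close>)
  show "rk_component \<tau> s A w (of_real (\<phi> l)) (\<lambda>i. of_real (ps i l)) (\<lambda>i. of_real (k4 i l)) (of_real (\<phi>' l))"
    by (rule rk_component_of_real) (use st up l in \<open>unfold rk_stages_def, blast+\<close>)
qed

lemma complex_of_real_2_Re_cnj: "complex_of_real (2 * Re (cnj z * k)) = z * cnj k + k * cnj z"
  by (simp add: complex_eq_iff)

lemma rk_stages_slope_abs_sq:
  assumes "rk_stages \<omega> \<kappa> \<nu> \<beta> q xa xb N \<tau> s A B \<rho> u \<phi> Bs rs us ps k1 k2 k3 k4"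
    and "i \<in> {1..s}" and "l < N"
  shows "complex_of_real (k4 i l) = Bs i l * cnj (k1 i l) + k1 i l * cnj (Bs i l)"
proof -
  have "k4 i l = 2 * Re (cnj (Bs i l) * k1 i l)"
    using assms unfolding rk_stages_def by blast
  then show ?thesis by (simp only: complex_of_real_2_Re_cnj)
qed

text \<open>The slope of \<phi> at each stage is precisely the Leibniz summand for \<open>B\<close>
  times its conjugate, so both quantities receive the same increment. Equality is claimed at the
  time levels only; the stages \<open>ps i\<close> stay independent of
  \<open>abs_sq (Bs i)\<close>.\<close>

lemma rk_step_abs_sq:
  assumes symp: "\<forall>i\<in>{1..s}. \<forall>j\<in>{1..s}. w i * A i j + w j * A j i = w i * w j"
    and step: "rk_step \<omega> \<kappa> \<nu> \<beta> q xa xb N \<tau> s A w B \<rho> u \<phi> B' \<rho>' u' \<phi>'"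
    and l: "l < N" and \<phi>: "complex_of_real (\<phi> l) = abs_sq B l"
  shows "complex_of_real (\<phi>' l) = abs_sq B' l"
proof -
  obtain Bs rs us ps k1 k2 k3 k4 where
    st: "rk_stages \<omega> \<kappa> \<nu> \<beta> q xa xb N \<tau> s A B \<rho> u \<phi> Bs rs us ps k1 k2 k3 k4" and
    up: "\<forall>l<N. B' l = B l + complex_of_real \<tau> * (\<Sum>i=1..s. complex_of_real (w i) * k1 i l) \<and>
          \<rho>' l = \<rho> l + \<tau> * (\<Sum>i=1..s. w i * k2 i l) \<and>
          u' l = u l + \<tau> * (\<Sum>i=1..s. w i * k3 i l) \<and>
          \<phi>' l = \<phi> l + \<tau> * (\<Sum>i=1..s. w i * k4 i l)"
    using step unfolding rk_step_def by blast
  note comp = rk_stages_components[OF st up l]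
  have "complex_of_real (\<phi>' l) = of_real (\<phi> l) + of_real \<tau> * (\<Sum>i=1..s. of_real (w i) * of_real (k4 i l))"
    using comp(4) by (simp add: rk_component_def)
  also have "\<dots> = B l * cnj (B l) + of_real \<tau> *
      (\<Sum>i=1..s. of_real (w i) * (Bs i l * cnj (k1 i l) + k1 i l * cnj (Bs i l)))"
    by (simp add: rk_stages_slope_abs_sq[OF st _ l] \<phi> abs_sq_def)
  also have "\<dots> = B' l * cnj (B' l)"
    by (rule rk_component_mult[OF symp comp(1) rk_component_cnj[OF comp(1)], symmetric])
  finally show ?thesis by (simp add: abs_sq_def)
qed

section \<open>The quadratic energy and its conservation\<close>

lemma energy_h_eq:
  assumes "\<And>l. l < N \<Longrightarrow> complex_of_real (\<phi> l) = abs_sq B l"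
  shows "energy_h \<omega> \<kappa> \<nu> \<beta> q xa xb N B \<rho> u =
    of_real (mesh_size xa xb N) * (\<Sum>l<N.
      of_real \<omega> * (mesh_diff xa xb N 2 B l * cnj (B l))
      - of_real \<kappa> * (of_real (u l) * of_real (\<phi> l))
      + of_real \<kappa> * of_real (\<nu> / 2) * (of_real (\<rho> l) * of_real (\<phi> l))
      - of_real \<kappa> * of_real (q / 2) * (of_real (\<phi> l) * of_real (\<phi> l))
      - of_real (\<beta> / 2) * (of_real (\<rho> l) * of_real (\<rho> l))
      - 1 / 2 * (of_real (u l) * of_real (u l))
      + of_real \<nu> * (of_real (u l) * of_real (\<rho> l)))"
proof -
  have 1: "inner_h xa xb N (\<lambda>j. complex_of_real (u j) - complex_of_real (\<nu> / 2) * complex_of_real (\<rho> j)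
                + complex_of_real (q / 2) * abs_sq B j) (abs_sq B) =
     of_real (mesh_size xa xb N) * (\<Sum>l<N. (of_real (u l) - of_real (\<nu> / 2) * of_real (\<rho> l)
                + of_real (q / 2) * of_real (\<phi> l)) * of_real (\<phi> l))"
    unfolding inner_h_def
    \<comment> \<open>\<open>abs_sq\<close> takes real values, so the conjugation in
      \<open>inner_h\<close> has no effect on it.\<close>
    by (intro arg_cong2[of _ _ _ _ times] refl sum.cong) (auto simp: assms, auto simp: abs_sq_def)
  show ?thesis
    unfolding energy_h_def 1
    by (simp add: inner_h_def cmesh_of_def sum.distrib sum_subtractf sum_distrib_left algebra_simps)
qed

text \<open>Collecting by slopes exposes the Hamiltonian structure: the coefficient of
  \<open>k4\<close> is minus the potential in the equation for \<open>B\<close>, and the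
  coefficients of \<open>k3\<close> and \<open>k2\<close> are the fluxes whose first differences
  define \<open>k2\<close> and \<open>k3\<close> respectively.\<close>

lemma energy_increment_regroup:
  fixes v r p k2 k3 k4 \<nu> \<kappa> \<beta> q :: real and x :: complex
  shows "x - of_real \<kappa> * (of_real v * of_real k4 + of_real k3 * of_real p)
      + of_real \<kappa> * of_real (\<nu> / 2) * (of_real r * of_real k4 + of_real k2 * of_real p)
      - of_real \<kappa> * of_real (q / 2) * (of_real p * of_real k4 + of_real k4 * of_real p)
      - of_real (\<beta> / 2) * (of_real r * of_real k2 + of_real k2 * of_real r)
      - 1 / 2 * (of_real v * of_real k3 + of_real k3 * of_real v)
      + of_real \<nu> * (of_real v * of_real k2 + of_real k3 * of_real r) =
    x - of_real (\<kappa> * (v - \<nu> / 2 * r + q * p)) * of_real k4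
      + (of_real (- v + \<nu> * r - \<kappa> * p) * of_real k3
      + of_real (- \<beta> * r + \<nu> * v + \<kappa> * \<nu> / 2 * p) * of_real k2)"
  by (simp add: algebra_simps)

lemma stage_increment_eq_0:
  assumes st: "rk_stages \<omega> \<kappa> \<nu> \<beta> q xa xb N \<tau> s A B \<rho> u \<phi> Bs rs us ps k1 k2 k3 k4"
    and i: "i \<in> {1..s}"
  shows "(\<Sum>l<N.
      of_real \<omega> * (mesh_diff xa xb N 2 (Bs i) l * cnj (k1 i l) + mesh_diff xa xb N 2 (k1 i) l * cnj (Bs i l))
      - of_real \<kappa> * (of_real (us i l) * of_real (k4 i l) + of_real (k3 i l) * of_real (ps i l))
      + of_real \<kappa> * of_real (\<nu> / 2) * (of_real (rs i l) * of_real (k4 i l) + of_real (k2 i l) * of_real (ps i l))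
      - of_real \<kappa> * of_real (q / 2) * (of_real (ps i l) * of_real (k4 i l) + of_real (k4 i l) * of_real (ps i l))
      - of_real (\<beta> / 2) * (of_real (rs i l) * of_real (k2 i l) + of_real (k2 i l) * of_real (rs i l))
      - 1 / 2 * (of_real (us i l) * of_real (k3 i l) + of_real (k3 i l) * of_real (us i l))
      + of_real \<nu> * (of_real (us i l) * of_real (k2 i l) + of_real (k3 i l) * of_real (rs i l))) = (0 :: complex)"
    (is "(\<Sum>l<N. ?e l) = 0")
proof -
  define P where "P = cmesh_of (\<lambda>m. - us i m + \<nu> * rs i m - \<kappa> * ps i m)"
  define Q where "Q = cmesh_of (\<lambda>m. - \<beta> * rs i m + \<nu> * us i m + \<kappa> * \<nu> / 2 * ps i m)"
  define F where "F l = mesh_diff xa xb N 2 (Bs i) l" for l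
  define V where "V l = complex_of_real (\<kappa> * (us i l - \<nu> / 2 * rs i l + q * ps i l))" for l
  have k1: "k1 i l = \<i> * (of_real \<omega> * F l - V l * Bs i l)"
    and k2: "complex_of_real (k2 i l) = mesh_diff xa xb N 1 P l"
    and k3: "complex_of_real (k3 i l) = mesh_diff xa xb N 1 Q l"
    if "l < N" for l
    using st i that unfolding rk_stages_def F_def V_def P_def Q_def
    by blast+
  have V: "cnj (V l) = V l" for l by (simp add: V_def)
  \<comment> \<open>With B the stage value, both sides equal i \<omega> V (F cnj B - B cnj F): the
    terms in |F|^2 and |B|^2 cancel because \<omega> and V are real.\<close>
  have B0: "of_real \<omega> * (F l * cnj (k1 i l) + cnj (F l) * k1 i l) = V l * of_real (k4 i l)"
    if "l < N" for l
    unfolding rk_stages_slope_abs_sq[OF st i that] unfolding k1[OF that] by (simp add: V algebra_simps)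
  \<comment> \<open>Symmetry moves the second difference from the slope to the conjugated stage, and
    reality of the matrix turns the result into \<open>cnj (F l)\<close>.\<close>
  have "(\<Sum>l<N. mesh_diff xa xb N 2 (k1 i) l * cnj (Bs i l)) = (\<Sum>l<N. cnj (F l) * k1 i l)"
    by (subst sum_mesh_diff_swap) (simp add: F_def cnj_mesh_diff mult_ac)
  then have "(\<Sum>l<N. of_real \<omega> * (F l * cnj (k1 i l) + mesh_diff xa xb N 2 (k1 i) l * cnj (Bs i l))) =
      (\<Sum>l<N. of_real \<omega> * (F l * cnj (k1 i l) + cnj (F l) * k1 i l))"
    by (simp add: sum.distrib flip: sum_distrib_left)
  also have "\<dots> = (\<Sum>l<N. V l * of_real (k4 i l))"
    using B0 by simp
  finally have B_part: "(\<Sum>l<N. of_real \<omega> * (F l * cnj (k1 i l) + mesh_diff xa xb N 2 (k1 i) l * cnj (Bs i l))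
      - V l * of_real (k4 i l)) = 0"
    by (simp add: sum_subtractf)
  have "?e l = of_real \<omega> * (F l * cnj (k1 i l) + mesh_diff xa xb N 2 (k1 i) l * cnj (Bs i l))
      - V l * of_real (k4 i l) + (P l * of_real (k3 i l) + Q l * of_real (k2 i l))" for l
    unfolding F_def V_def P_def Q_def cmesh_of_def by (rule energy_increment_regroup)
  then have "(\<Sum>l<N. ?e l) = (\<Sum>l<N. P l * of_real (k3 i l) + Q l * of_real (k2 i l))"
    by (simp only: sum.distrib B_part add_0)
  also have "\<dots> = (\<Sum>l<N. P l * mesh_diff xa xb N 1 Q l) + (\<Sum>l<N. mesh_diff xa xb N 1 P l * Q l)"
    by (simp add: k2 k3 sum.distrib mult.commute)
  \<comment> \<open>The two pairings of \<open>P\<close> and \<open>Q\<close> are opposite by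
    antisymmetry of the first difference.\<close>
  also have "\<dots> = 0"
    by (simp only: sum_mesh_diff_swap) simp
  finally show ?thesis .
qed

text \<open>The shape is that of the seven energy terms. Keeping the products opaque splits off the
  increment by matching alone, without normalising the full expression.\<close>

lemma linear_combination_add:
  fixes c1 :: "'a::comm_ring"
  shows "c1 * (x1 + y1) - c2 * (x2 + y2) + c3 * (x3 + y3) - c4 * (x4 + y4) - c5 * (x5 + y5)
      - c6 * (x6 + y6) + c7 * (x7 + y7) =
    (c1 * x1 - c2 * x2 + c3 * x3 - c4 * x4 - c5 * x5 - c6 * x6 + c7 * x7)
      + (c1 * y1 - c2 * y2 + c3 * y3 - c4 * y4 - c5 * y5 - c6 * y6 + c7 * y7)"
proof -
  have plus: "p + q = (a + c) + (b + d)" if "p = a + b" and "q = c + d" for p q a b c d :: 'a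
    unfolding that by (simp only: ac_simps)
  have minus: "p - q = (a - c) + (b - d)" if "p = a + b" and "q = c + d" for p q a b c d :: 'a
    unfolding that by (simp only: add_diff_add)
  show ?thesis
    by (intro plus minus distrib_left)
qed

lemma rk_step_energy_h:
  assumes symp: "\<forall>i\<in>{1..s}. \<forall>j\<in>{1..s}. w i * A i j + w j * A j i = w i * w j"
    and step: "rk_step \<omega> \<kappa> \<nu> \<beta> q xa xb N \<tau> s A w B \<rho> u \<phi> B' \<rho>' u' \<phi>'"
    and \<phi>: "\<And>l. l < N \<Longrightarrow> complex_of_real (\<phi> l) = abs_sq B l"
  shows "energy_h \<omega> \<kappa> \<nu> \<beta> q xa xb N B' \<rho>' u' = energy_h \<omega> \<kappa> \<nu> \<beta> q xa xb N B \<rho> u"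
proof -
  obtain Bs rs us ps k1 k2 k3 k4 where
    st: "rk_stages \<omega> \<kappa> \<nu> \<beta> q xa xb N \<tau> s A B \<rho> u \<phi> Bs rs us ps k1 k2 k3 k4" and
    up: "\<forall>l<N. B' l = B l + complex_of_real \<tau> * (\<Sum>i=1..s. complex_of_real (w i) * k1 i l) \<and>
          \<rho>' l = \<rho> l + \<tau> * (\<Sum>i=1..s. w i * k2 i l) \<and>
          u' l = u l + \<tau> * (\<Sum>i=1..s. w i * k3 i l) \<and>
          \<phi>' l = \<phi> l + \<tau> * (\<Sum>i=1..s. w i * k4 i l)"
    using step unfolding rk_step_def by blast
  note comp = rk_stages_components[OF st up]
  note prod = rk_component_mult[OF symp]
  \<comment> \<open>\<open>S\<close> is the update functional. Being linear, it merges the seven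
    Leibniz increments into one and commutes with the sum over the mesh.\<close>
  define S where "S f = complex_of_real \<tau> * (\<Sum>i=1..s. of_real (w i) * f i)" for f :: "nat \<Rightarrow> complex"
  have S_add: "S (\<lambda>i. f i + g i) = S f + S g" and S_diff: "S (\<lambda>i. f i - g i) = S f - S g"
    and S_scale: "S (\<lambda>i. c * f i) = c * S f" for f g c
    by (simp_all add: S_def algebra_simps sum.distrib sum_subtractf sum_distrib_left)
  have S_sum: "(\<Sum>l<N. S (f l)) = S (\<lambda>i. \<Sum>l<N. f l i)" for f
    unfolding S_def sum_distrib_left by (rule sum.swap)
  have \<phi>': "complex_of_real (\<phi>' l) = abs_sq B' l" if "l < N" for l
    using rk_step_abs_sq[OF symp step that \<phi>[OF that]] by simp
  have comp_diff: "rk_component \<tau> s A w (mesh_diff xa xb N 2 B l) (\<lambda>i. mesh_diff xa xb N 2 (Bs i) l)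
      (\<lambda>i. mesh_diff xa xb N 2 (k1 i) l) (mesh_diff xa xb N 2 B' l)" for l
    by (rule rk_component_mesh_diff) (rule comp(1))
  \<comment> \<open>The products follow the order of the energy terms. The first needs the bound on
    \<open>l\<close> once, since \<open>comp_diff\<close> holds for every \<open>l\<close>; the
    others need it twice.\<close>
  note quad = prod[OF comp_diff rk_component_cnj[OF comp(1)], folded S_def]
    prod[OF comp(3) comp(4), folded S_def] prod[OF comp(2) comp(4), folded S_def]
    prod[OF comp(4) comp(4), folded S_def] prod[OF comp(2) comp(2), folded S_def]
    prod[OF comp(3) comp(3), folded S_def] prod[OF comp(3) comp(2), folded S_def]
  define e where "e i l =
      of_real \<omega> * (mesh_diff xa xb N 2 (Bs i) l * cnj (k1 i l) + mesh_diff xa xb N 2 (k1 i) l * cnj (Bs i l))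
      - of_real \<kappa> * (of_real (us i l) * of_real (k4 i l) + of_real (k3 i l) * of_real (ps i l))
      + of_real \<kappa> * of_real (\<nu> / 2) * (of_real (rs i l) * of_real (k4 i l) + of_real (k2 i l) * of_real (ps i l))
      - of_real \<kappa> * of_real (q / 2) * (of_real (ps i l) * of_real (k4 i l) + of_real (k4 i l) * of_real (ps i l))
      - of_real (\<beta> / 2) * (of_real (rs i l) * of_real (k2 i l) + of_real (k2 i l) * of_real (rs i l))
      - 1 / 2 * (of_real (us i l) * of_real (k3 i l) + of_real (k3 i l) * of_real (us i l))
      + complex_of_real \<nu> * (of_real (us i l) * of_real (k2 i l) + of_real (k3 i l) * of_real (rs i l))" for i l
  have e: "(\<Sum>l<N. e i l) = 0" if "i \<in> {1..s}" for i
    unfolding e_def by (rule stage_increment_eq_0[OF st that])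
  define E where "E b r v p l =
      of_real \<omega> * (mesh_diff xa xb N 2 b l * cnj (b l))
      - of_real \<kappa> * (of_real (v l) * of_real (p l))
      + of_real \<kappa> * of_real (\<nu> / 2) * (of_real (r l) * of_real (p l))
      - of_real \<kappa> * of_real (q / 2) * (of_real (p l) * of_real (p l))
      - of_real (\<beta> / 2) * (of_real (r l) * of_real (r l))
      - 1 / 2 * (of_real (v l) * of_real (v l))
      + complex_of_real \<nu> * (of_real (v l) * of_real (r l))"
    for b :: cmesh and r v p :: rmesh and l
  have "E B' \<rho>' u' \<phi>' l = E B \<rho> u \<phi> l + S (\<lambda>i. e i l)" if "l < N" for l
    unfolding E_def e_def quad(1)[OF that] quad(2-)[OF that that] S_add S_diff S_scale
    by (rule linear_combination_add)
  then have "(\<Sum>l<N. E B' \<rho>' u' \<phi>' l) = (\<Sum>l<N. E B \<rho> u \<phi> l) + S (\<lambda>i. \<Sum>l<N. e i l)"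
    by (simp add: sum.distrib S_sum)
  also have "S (\<lambda>i. \<Sum>l<N. e i l) = 0"
    by (simp add: S_def e)
  finally have "(\<Sum>l<N. E B' \<rho>' u' \<phi>' l) = (\<Sum>l<N. E B \<rho> u \<phi> l)" by simp
  moreover have "energy_h \<omega> \<kappa> \<nu> \<beta> q xa xb N B \<rho> u =
      of_real (mesh_size xa xb N) * (\<Sum>l<N. E B \<rho> u \<phi> l)"
    unfolding E_def by (rule energy_h_eq) (rule \<phi>)
  moreover have "energy_h \<omega> \<kappa> \<nu> \<beta> q xa xb N B' \<rho>' u' =
      of_real (mesh_size xa xb N) * (\<Sum>l<N. E B' \<rho>' u' \<phi>' l)"
    unfolding E_def by (rule energy_h_eq) (rule \<phi>')
  ultimately show ?thesis by simp
qed

theorem theorem3p3: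
  fixes \<omega> \<kappa> \<nu> \<beta> q xa xb \<tau> :: real
    and N s :: nat
    and A :: "nat \<Rightarrow> nat \<Rightarrow> real" and w :: "nat \<Rightarrow> real"
    and B :: "nat \<Rightarrow> cmesh" and \<rho> u \<phi> :: "nat \<Rightarrow> rmesh"
  assumes "\<beta> \<noteq> \<nu>\<^sup>2"
    and "q = \<kappa> + \<nu> * (\<kappa> * \<nu> - 1) / (4 * (\<beta> - \<nu>\<^sup>2))"
    and "xa < xb"
    and "N > 0" and "even N"
    and "\<tau> > 0"
    and "s \<ge> 1"
    and "\<And>i j. i \<in> {1..s} \<Longrightarrow> j \<in> {1..s} \<Longrightarrow> w i * A i j + w j * A j i = w i * w j"
    and "\<And>n. rk_step \<omega> \<kappa> \<nu> \<beta> q xa xb N \<tau> s A w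
               (B n) (\<rho> n) (u n) (\<phi> n) (B (Suc n)) (\<rho> (Suc n)) (u (Suc n)) (\<phi> (Suc n))"
    and "\<And>j. j < N \<Longrightarrow> complex_of_real (\<phi> 0 j) = abs_sq (B 0) j"
  shows "\<forall>n. energy_h \<omega> \<kappa> \<nu> \<beta> q xa xb N (B (Suc n)) (\<rho> (Suc n)) (u (Suc n))
           = energy_h \<omega> \<kappa> \<nu> \<beta> q xa xb N (B n) (\<rho> n) (u n)"
proof
  fix n
  have symp: "\<forall>i\<in>{1..s}. \<forall>j\<in>{1..s}. w i * A i j + w j * A j i = w i * w j"
    using assms(8) by blast
  \<comment> \<open>The energy contains \<open>abs_sq (B n)\<close>, whereas the scheme evolves
    \<phi>; the constraint must hold at every level before the one-step result applies.\<close>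
  have \<phi>: "complex_of_real (\<phi> n l) = abs_sq (B n) l" if "l < N" for l
  proof (induction n)
    case 0
    show ?case by (rule assms(10)[OF that])
  next
    case (Suc n)
    show ?case by (rule rk_step_abs_sq[OF symp assms(9) that Suc])
  qed
  show "energy_h \<omega> \<kappa> \<nu> \<beta> q xa xb N (B (Suc n)) (\<rho> (Suc n)) (u (Suc n))
           = energy_h \<omega> \<kappa> \<nu> \<beta> q xa xb N (B n) (\<rho> n) (u n)"
    by (rule rk_step_energy_h[OF symp assms(9)]) (rule \<phi>)
qed

end
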